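(* Let $k\ge2$, $\Sigma=\{0,1,\dots,k-1\}$, let $\Delta$ be a nonempty subset of $\Sigma\setminus\{0\}$, and let $B\subseteq\Sigma^*$ be a finite instantaneous code. Let \[A=\{n\in\mathbb{Z}^+\mid \mathrm{rep}_k(n)\in\Delta B^*\}.\] Then $\mathrm{Dim}_\zeta(A)=s^*$, where $s^*$ is the unique solution of the equation $\sum_{w\in B}k^{-s^*|w|}=1$.
   Context: For $A\subseteq\mathbb{Z}^+$, $\mathrm{Dim}_\zeta(A)=\inf\{s\ge0\mid\sum_{n\in A}n^{-s}<\infty\}$. $\mathrm{rep}_k(n)$ denotes the base-$k$ expansion of the positive integer $n$ as a string over $\Sigma$ (no leading zeros). A prefix set over $\Sigma$ is a set $B\subseteq\Sigma^*$ in which no element is a proper prefix of another element; an instantaneous code is a nonempty prefix set not containing the empty string. $|w|$ is the length of the string $w$, $B^*$ is the set of all finite concatenations of elements of $B$ (including the empty string), and $\Delta B^*=\{aw\mid a\in\Delta, w\in B^*\}$ (digits of $\Delta$ viewed as length-one strings). *)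

theory Defs
  imports "HOL-Analysis.Analysis" "HOL-Library.Sublist"
begin

text \<open>The zeta-dimension of a set of positive integers. The terms are nonnegative, so
  unconditional summability over \<open>A\<close> is convergence of the series in the usual sense. The set
  whose infimum is taken is nonempty (it contains every \<open>s > 1\<close>) and bounded below by 0, so the
  real-valued \<^const>\<open>Inf\<close> is the genuine infimum.\<close>

definition dim_zeta :: "nat set \<Rightarrow> real" where
  "dim_zeta A = Inf {s. s \<ge> 0 \<and> (\<lambda>n. real n powr (- s)) summable_on A}"

text \<open>The base-\<open>k\<close> expansion, most significant digit first and without leading zeros. The guard
  \<open>k < 2\<close> serves only to make the function total.\<close>

function rep :: "nat \<Rightarrow> nat \<Rightarrow> nat list" where
  "rep k n = (if k < 2 \<or> n = 0 then [] else rep k (n div k) @ [n mod k])"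
  by pat_completeness auto
termination by (relation "Wellfounded.measure snd") auto

declare rep.simps [simp del]

lemma rep_value:
  assumes "k \<ge> 2"
  shows "foldl (\<lambda>m d. k * m + d) 0 (rep k n) = n"
  using assms
proof (induction k n rule: rep.induct)
  case (1 k n)
  then show ?case by (subst rep.simps) auto
qed

lemma rep_digits: "set (rep k n) \<subseteq> {..<k}"
proof (induction k n rule: rep.induct)
  case (1 k n)
  then show ?case by (subst rep.simps) auto
qed

lemma rep_no_leading_zero:
  assumes "k \<ge> 2" "n > 0"
  shows "rep k n \<noteq> [] \<and> hd (rep k n) \<noteq> 0"
  using assms
proof (induction k n rule: rep.induct)
  case (1 k n)
  show ?case
  proof (cases "n < k")
    case True
    with 1 show ?thesis by (subst (1 2) rep.simps) (simp add: rep.simps[of k 0])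
  next
    case False
    with 1 have "rep k (n div k) \<noteq> [] \<and> hd (rep k (n div k)) \<noteq> 0"
      by (simp add: div_greater_zero_iff)
    with 1 show ?thesis by (subst (1 2) rep.simps) simp
  qed
qed

definition prefix_set :: "'a list set \<Rightarrow> bool" where
  "prefix_set B \<longleftrightarrow> (\<forall>u\<in>B. \<forall>v\<in>B. \<not> strict_prefix u v)"

definition instantaneous_code :: "'a list set \<Rightarrow> bool" where
  "instantaneous_code B \<longleftrightarrow> prefix_set B \<and> B \<noteq> {} \<and> [] \<notin> B"

definition kleene_star :: "'a list set \<Rightarrow> 'a list set" where
  "kleene_star B = {concat ws |ws. set ws \<subseteq> B}"

end

theory Submission
  imports Defs
begin

text \<open>
  Put \<open>x = k powr (- s)\<close> and \<open>q = (\<Sum>w\<in>B. x ^ length w)\<close>. Unique decodability of the prefix code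
  turns \<open>\<Sum>w\<in>B\<^sup>*. x ^ length w\<close> into the geometric series \<open>\<Sum>m. q ^ m\<close>. A number with
  expansion \<open>a # w\<close> lies between \<open>k ^ length w\<close> and \<open>k ^ Suc (length w)\<close>, so the series over \<open>A\<close>
  converges at \<open>s \<ge> 0\<close> iff \<open>q < 1\<close>, that is, iff \<open>s\<close> exceeds the root of \<open>q = 1\<close>.
\<close>

section \<open>Unique decodability of prefix codes and power sums over
  \<open>kleene_star B\<close>\<close>

lemma inj_on_concat_instantaneous_code:
  assumes "instantaneous_code B"
  shows "inj_on concat (lists B)"
proof (rule inj_onI)
  fix us vs
  assume "us \<in> lists B" "vs \<in> lists B" "concat us = concat vs"
  then show "us = vs"
  proof (induction us arbitrary: vs rule: list.induct)
    case Nil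
    then show ?case
      using assms by (cases vs) (auto simp: instantaneous_code_def)
  next
    case (Cons u us)
    \<comment> \<open>\<open>vs\<close> cannot be empty: \<open>u\<close> is a code word, hence
      nonempty, so the common concatenation is nonempty.\<close>
    then obtain v vs' where vs: "vs = v # vs'"
      using assms by (cases vs) (auto simp: instantaneous_code_def)
    have eq: "u @ concat us = v @ concat vs'"
      using Cons.prems vs by simp
    \<comment> \<open>Two prefixes of the same string are comparable, and the prefix property leaves
      only equality. Cancelling the first word reduces the claim to \<open>us\<close>.\<close>
    have "prefix u v \<or> prefix v u"
      using eq by (metis prefixI prefix_same_cases)
    moreover have "u \<in> B" "v \<in> B"
      using Cons.prems vs by simp_all
    ultimately have "u = v"
      using assms unfolding instantaneous_code_def prefix_set_def strict_prefix_def by metis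
    then show ?case
      using Cons vs eq by auto
  qed
qed

text \<open>Length is additive under concatenation, so a list of \<open>m\<close> words contributes
  the product of its weights; expanding the \<open>m\<close>-th power gives all such products. The
  index set consists of lists of words, not of their concatenations: unique decodability enters only
  in \<open>summable_on_kleene_star_iff\<close>.\<close>

lemma sum_power_length_concat:
  fixes x :: "'b::comm_semiring_1"
  assumes "finite B"
  shows "(\<Sum>ws | set ws \<subseteq> B \<and> length ws = m. x ^ length (concat ws)) = (\<Sum>w\<in>B. x ^ length w) ^ m"
proof (induction m)
  case 0
  have "{ws. set ws \<subseteq> B \<and> length ws = 0} = {[]}"
    by auto
  then show ?case
    by simp
next
  case (Suc m)
  let ?L = "{ws. set ws \<subseteq> B \<and> length ws = m}"
  have "{ws. set ws \<subseteq> B \<and> length ws = Suc m} = (\<lambda>(w, ws). w # ws) ` (B \<times> ?L)"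
    by (auto simp: length_Suc_conv image_iff)
  moreover have "inj_on (\<lambda>(w, ws). w # ws) (B \<times> ?L)"
    by (auto simp: inj_on_def)
  ultimately have "(\<Sum>ws | set ws \<subseteq> B \<and> length ws = Suc m. x ^ length (concat ws))
      = (\<Sum>(w, ws)\<in>B \<times> ?L. x ^ length w * x ^ length (concat ws))"
    by (simp add: sum.reindex case_prod_unfold power_add)
  also have "\<dots> = (\<Sum>w\<in>B. x ^ length w) * (\<Sum>ws\<in>?L. x ^ length (concat ws))"
    by (simp add: sum_product sum.cartesian_product)
  finally show ?case
    using Suc by simp
qed

lemma sum_power_length_concat_less:
  fixes x :: "'b::comm_semiring_1"
  assumes "finite B"
  shows "(\<Sum>ws | set ws \<subseteq> B \<and> length ws < M. x ^ length (concat ws))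
    = (\<Sum>m<M. (\<Sum>w\<in>B. x ^ length w) ^ m)"
proof -
  have "{ws. set ws \<subseteq> B \<and> length ws < M} = (\<Union>m\<in>{..<M}. {ws. set ws \<subseteq> B \<and> length ws = m})"
    by auto
  also have "(\<Sum>ws\<in>\<dots>. x ^ length (concat ws))
      = (\<Sum>m<M. \<Sum>ws | set ws \<subseteq> B \<and> length ws = m. x ^ length (concat ws))"
    using assms by (intro sum.UNION_disjoint) (auto intro: finite_lists_length_eq)
  finally show ?thesis
    by (simp only: sum_power_length_concat[OF assms])
qed

text \<open>The terms are nonnegative, so summability amounts to bounded finite sums. Truncating by
  the number of words gives finite sets whose sums are geometric partial sums, and every finite
  subset of \<open>lists B\<close> lies in one of them.\<close>

lemma summable_on_concat_lists_iff:
  fixes x :: real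
  assumes "finite B" and x: "0 \<le> x"
  shows "(\<lambda>ws. x ^ length (concat ws)) summable_on lists B \<longleftrightarrow> (\<Sum>w\<in>B. x ^ length w) < 1"
    (is "?f summable_on _ \<longleftrightarrow> ?q < 1")
proof
  have q: "0 \<le> ?q"
    using x by (simp add: sum_nonneg)
  have fin: "finite {ws. set ws \<subseteq> B \<and> length ws < M}" for M
    by (rule finite_subset[OF _ finite_lists_length_le[OF assms(1), of M]]) auto
  {
    assume sum: "?f summable_on lists B"
    have "(\<Sum>m<M. ?q ^ m) \<le> infsum ?f (lists B)" for M
    proof -
      have "sum ?f {ws. set ws \<subseteq> B \<and> length ws < M} \<le> infsum ?f (lists B)"
        by (rule finite_sum_le_infsum[OF sum fin]) (use x in auto)
      then show ?thesis
        by (simp only: sum_power_length_concat_less[OF assms(1)])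
    qed
    then have "summable (\<lambda>m. ?q ^ m)"
      using q by (intro summableI_nonneg_bounded) auto
    then show "?q < 1"
      using q by (simp add: summable_geometric_iff)
  next
    assume "?q < 1"
    then have sm: "summable (\<lambda>m. ?q ^ m)"
      using q by (simp add: summable_geometric_iff)
    have "sum ?f F \<le> (\<Sum>m. ?q ^ m)" if F: "finite F" "F \<subseteq> lists B" for F
    proof -
      obtain M where M: "\<forall>ws\<in>F. length ws < M"
        using F(1) by (metis finite_imageI finite_nat_set_iff_bounded imageI)
      have "sum ?f F \<le> sum ?f {ws. set ws \<subseteq> B \<and> length ws < M}"
        by (rule sum_mono2[OF fin]) (use F M x in auto)
      also have "\<dots> = (\<Sum>m<M. ?q ^ m)"
        by (rule sum_power_length_concat_less[OF assms(1)])
      also have "\<dots> \<le> (\<Sum>m. ?q ^ m)"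
        by (rule sum_le_suminf[OF sm]) (use q in auto)
      finally show ?thesis .
    qed
    then show "?f summable_on lists B"
      using x by (intro nonneg_bdd_above_summable_on bdd_aboveI2) auto
  }
qed

lemma kleene_star_eq_image: "kleene_star B = concat ` lists B"
  by (auto simp: kleene_star_def lists_eq_set)

lemma summable_on_kleene_star_iff:
  fixes x :: real
  assumes "finite B" "instantaneous_code B" "0 \<le> x"
  shows "(\<lambda>w. x ^ length w) summable_on kleene_star B \<longleftrightarrow> (\<Sum>w\<in>B. x ^ length w) < 1"
  using summable_on_concat_lists_iff[OF assms(1,3)]
  by (simp add: kleene_star_eq_image o_def
      summable_on_reindex[OF inj_on_concat_instantaneous_code[OF assms(2)]])

section \<open>Digit strings and the numbers they denote\<close>

definition digits_value :: "nat \<Rightarrow> nat list \<Rightarrow> nat" where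
  "digits_value k = foldl (\<lambda>m d. k * m + d) 0"

lemma digits_value_rep: "k \<ge> 2 \<Longrightarrow> digits_value k (rep k n) = n"
  by (simp add: digits_value_def rep_value)

lemma digits_value_snoc: "digits_value k (ds @ [d]) = k * digits_value k ds + d"
  by (simp add: digits_value_def)

lemma digits_value_bounds:
  assumes "a \<noteq> 0" "set (a # w) \<subseteq> {..<k}"
  shows "k ^ length w \<le> digits_value k (a # w)" "digits_value k (a # w) < k ^ Suc (length w)"
proof -
  have "k ^ length w \<le> digits_value k (a # w) \<and> digits_value k (a # w) < k ^ Suc (length w)"
    using assms
  proof (induction w rule: rev_induct)
    case Nil
    then show ?case
      by (simp add: digits_value_def)
  next
    case (snoc d w)
    \<comment> \<open>The strict bound is restated with \<open>Suc\<close> so that multiplying it by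
      \<open>k\<close> leaves room for one further digit: \<open>k * v + d < k * (v + 1)\<close>
      whenever \<open>d < k\<close>.\<close>
    then have IH: "k ^ length w \<le> digits_value k (a # w)" "Suc (digits_value k (a # w)) \<le> k ^ Suc (length w)"
      and "d < k"
      by auto
    have "k * k ^ length w \<le> k * digits_value k (a # w) + d"
      using mult_le_mono2[OF IH(1), of k] by (rule trans_le_add1)
    moreover have "k * Suc (digits_value k (a # w)) \<le> k * k ^ Suc (length w)"
      using IH(2) by (rule mult_le_mono2)
    ultimately show ?case
      using digits_value_snoc[of k "a # w" d] \<open>d < k\<close> by simp
  qed
  then show "k ^ length w \<le> digits_value k (a # w)" "digits_value k (a # w) < k ^ Suc (length w)"
    by auto
qed

text \<open>Together with \<open>digits_value_rep\<close> this makes \<open>rep k\<close> and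
  \<open>digits_value k\<close> mutually inverse between positive numbers and strings with nonzero
  leading digit. A positive value lets \<open>rep\<close> unfold, and division by \<open>k\<close>
  with remainder then splits off the last digit.\<close>

lemma rep_digits_value:
  assumes "a \<noteq> 0" "set (a # w) \<subseteq> {..<k}"
  shows "rep k (digits_value k (a # w)) = a # w"
  using assms
proof (induction w rule: rev_induct)
  case Nil
  then show ?case
    by (simp add: digits_value_def rep.simps[of k a] rep.simps[of k 0])
next
  case (snoc d w)
  have "digits_value k (a # w @ [d]) = k * digits_value k (a # w) + d"
    using digits_value_snoc[of k "a # w" d] by simp
  moreover have "k ^ length w \<le> digits_value k (a # w)" "0 < k" "d < k" "a < k"
    using digits_value_bounds(1)[of a w k] snoc.prems by auto
  moreover have "0 < digits_value k (a # w)"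
    using calculation by (meson less_le_trans zero_less_power)
  ultimately show ?case
    using snoc rep.simps[of k "k * digits_value k (a # w) + d"] by auto
qed

text \<open>For \<open>0 \<le> s\<close> the function \<open>n powr (- s)\<close> is nonincreasing,
  so \<open>digits_value_bounds\<close> puts the term of \<open>a # w\<close> between
  \<open>x ^ Suc (length w)\<close> and \<open>x ^ length w\<close>, where
  \<open>x = k powr (- s)\<close>. The two bounds differ by the constant factor
  \<open>x > 0\<close>, so the series converges exactly when the power sum over
  \<open>kleene_star B\<close> does.\<close>

lemma summable_on_digits_value_iff:
  fixes s :: real
  assumes "a \<noteq> 0" "a < k" "B \<subseteq> lists {..<k}" "finite B" "instantaneous_code B" "0 \<le> s"
  shows "(\<lambda>n. real n powr (- s)) summable_on (\<lambda>w. digits_value k (a # w)) ` kleene_star B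
    \<longleftrightarrow> (\<Sum>w\<in>B. (real k powr (- s)) ^ length w) < 1"
proof -
  let ?v = "\<lambda>w. digits_value k (a # w)"
  let ?x = "real k powr (- s)"
  have digits: "set (a # w) \<subseteq> {..<k}" if "w \<in> kleene_star B" for w
    using that assms(2,3) by (fastforce simp: kleene_star_def)
  have inj: "inj_on ?v (kleene_star B)"
    by (rule inj_onI) (metis assms(1) digits list.inject rep_digits_value)
  have k: "0 < real k"
    using assms(2) by simp
  have power: "real (k ^ m) powr (- s) = ?x ^ m" for m
    using k by (simp add: powr_realpow[symmetric] powr_powr mult.commute)
  have upper: "real (?v w) powr (- s) \<le> ?x ^ length w"
    and lower: "?x * ?x ^ length w \<le> real (?v w) powr (- s)" if "w \<in> kleene_star B" for w
  proof -
    note b = digits_value_bounds[OF assms(1) digits[OF that]]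
    have pos: "0 < k ^ length w"
      using k by simp
    have "real (?v w) powr (- s) \<le> real (k ^ length w) powr (- s)"
      by (rule powr_mono2') (use b(1) pos assms(6) in \<open>simp_all only: of_nat_le_iff of_nat_0_less_iff neg_le_0_iff_le\<close>)
    then show "real (?v w) powr (- s) \<le> ?x ^ length w"
      by (simp only: power)
    have "real (k ^ Suc (length w)) powr (- s) \<le> real (?v w) powr (- s)"
      by (rule powr_mono2') (use b pos assms(6) in \<open>simp_all only: of_nat_le_iff of_nat_0_less_iff neg_le_0_iff_le\<close>)
    then show "?x * ?x ^ length w \<le> real (?v w) powr (- s)"
      unfolding power by simp
  qed
  have "(\<lambda>w. real (?v w) powr (- s)) summable_on kleene_star B
      \<longleftrightarrow> (\<lambda>w. ?x ^ length w) summable_on kleene_star B"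
  proof
    assume "(\<lambda>w. real (?v w) powr (- s)) summable_on kleene_star B"
    then have "(\<lambda>w. ?x * ?x ^ length w) summable_on kleene_star B"
      by (rule summable_on_comparison_test) (use lower in auto)
    then show "(\<lambda>w. ?x ^ length w) summable_on kleene_star B"
      using k by (subst (asm) summable_on_cmult_right') auto
  next
    assume "(\<lambda>w. ?x ^ length w) summable_on kleene_star B"
    then show "(\<lambda>w. real (?v w) powr (- s)) summable_on kleene_star B"
      by (rule summable_on_comparison_test) (use upper in auto)
  qed
  then show ?thesis
    using summable_on_kleene_star_iff[OF assms(4,5), of ?x]
    by (simp add: summable_on_reindex[OF inj] o_def)
qed

lemma summable_on_finite_UN:
  fixes f :: "'a \<Rightarrow> 'b::banach"
  assumes "finite I" "\<And>i. i \<in> I \<Longrightarrow> f summable_on A i"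
  shows "f summable_on (\<Union>i\<in>I. A i)"
  using assms
proof (induction I rule: finite_induct)
  case empty
  then show ?case
    by simp
next
  case (insert i I)
  then have "f summable_on A i" and I: "f summable_on (\<Union>i\<in>I. A i)"
    by simp_all
  \<comment> \<open>The sets may overlap, so only the part of the union outside \<open>A i\<close>
    is added to \<open>A i\<close>.\<close>
  moreover have "f summable_on (\<Union>i\<in>I. A i) - A i"
    by (rule summable_on_subset_banach[OF I]) blast
  ultimately have "f summable_on (A i \<union> ((\<Union>i\<in>I. A i) - A i))"
    by (intro summable_on_Un_disjoint) auto
  then show ?case
    by simp
qed

theorem theorem5p1:
  fixes k :: nat and \<Sigma> \<Delta> A :: "nat set" and B :: "nat list set"
  assumes "k \<ge> 2"
    and "\<Sigma> = {0..<k}"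
    and "\<Delta> \<noteq> {}" and "\<Delta> \<subseteq> \<Sigma> - {0}"
    and "B \<subseteq> lists \<Sigma>" and "finite B" and "instantaneous_code B"
    and "A = {n. n > 0 \<and> rep k n \<in> {a # w |a w. a \<in> \<Delta> \<and> w \<in> kleene_star B}}"
  shows "(\<exists>!s::real. (\<Sum>w\<in>B. real k powr (- s * real (length w))) = 1) \<and>
    dim_zeta A = (THE s::real. (\<Sum>w\<in>B. real k powr (- s * real (length w))) = 1)"
proof -
  define q where "q s = (\<Sum>w\<in>B. real k powr (- s * real (length w)))" for s
  have B: "B \<noteq> {}" "\<And>w. w \<in> B \<Longrightarrow> length w > 0"
    using assms(7) by (auto simp: instantaneous_code_def)
  have digits: "B \<subseteq> lists {..<k}"
    using assms(2,5) by (simp add: atLeast0LessThan)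
  have q_power: "q s = (\<Sum>w\<in>B. (real k powr (- s)) ^ length w)" for s
    unfolding q_def using assms(1)
    by (intro sum.cong refl) (simp add: powr_powr flip: powr_realpow)
  \<comment> \<open>Each term decreases strictly, since \<open>k > 1\<close> and every code word has
    positive length. This yields uniqueness of the root as well as the sign of
    \<open>q s - 1\<close> on either side of it.\<close>
  have q_less: "q t < q s" if "s < t" for s t
    unfolding q_def using that assms(1,6) B
    by (intro sum_strict_mono powr_less_mono) auto
  \<comment> \<open>In the variable \<open>x = k powr (- s)\<close> the equation is polynomial. At
    \<open>0\<close> the sum vanishes because all code words are nonempty; at \<open>1\<close> it is
    \<open>card B \<ge> 1\<close>.\<close>
  have "\<exists>x\<ge>0. x \<le> 1 \<and> (\<Sum>w\<in>B. x ^ length w) = (1::real)"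
  proof (rule IVT')
    show "(\<Sum>w\<in>B. (0::real) ^ length w) \<le> 1"
      using B(2) by (simp add: power_0_left)
    show "1 \<le> (\<Sum>w\<in>B. (1::real) ^ length w)"
      using B(1) assms(6) by (simp add: Suc_le_eq card_gt_0_iff)
  qed (auto intro!: continuous_intros)
  then obtain x where x: "0 \<le> x" "x \<le> 1" "(\<Sum>w\<in>B. x ^ length w) = (1::real)"
    by blast
  have "x \<noteq> 0"
  proof
    assume "x = 0"
    then have "(\<Sum>w\<in>B. x ^ length w) = 0"
      using B(2) by (intro sum.neutral) auto
    then show False
      using x(3) by simp
  qed
  \<comment> \<open>This solves \<open>k powr (- r) = x\<close>, using \<open>x > 0\<close>; the
    bound \<open>x \<le> 1\<close> makes \<open>r\<close> nonnegative.\<close>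
  define r where "r = - log k x"
  have "real k powr (- r) = x"
    using x(1) \<open>x \<noteq> 0\<close> assms(1) by (simp add: r_def)
  then have r: "q r = 1"
    using x(3) by (simp add: q_power)
  have "0 \<le> r"
    using x(1,2) \<open>x \<noteq> 0\<close> assms(1) by (simp add: r_def)
  have root: "q s = 1 \<longleftrightarrow> s = r" for s
    using q_less[of s r] q_less[of r s] r by (cases s r rule: linorder_cases) auto
  have q_lt_1: "q s < 1 \<longleftrightarrow> r < s" for s
    using q_less[of s r] q_less[of r s] r by (cases s r rule: linorder_cases) auto

  have \<Delta>: "a \<noteq> 0" "a < k" if "a \<in> \<Delta>" for a
    using that assms(2,4) by auto
  \<comment> \<open>\<open>A\<close> is split by leading digit, so that each piece is an image of
    \<open>kleene_star B\<close>.\<close>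
  have A: "A = (\<Union>a\<in>\<Delta>. (\<lambda>w. digits_value k (a # w)) ` kleene_star B)"
  proof (rule set_eqI, rule iffI)
    fix n assume "n \<in> A"
    then show "n \<in> (\<Union>a\<in>\<Delta>. (\<lambda>w. digits_value k (a # w)) ` kleene_star B)"
      using digits_value_rep[OF assms(1), of n] by (force simp: assms(8))
  next
    fix n assume "n \<in> (\<Union>a\<in>\<Delta>. (\<lambda>w. digits_value k (a # w)) ` kleene_star B)"
    then obtain a w where aw: "a \<in> \<Delta>" "w \<in> kleene_star B" "n = digits_value k (a # w)"
      by blast
    have "set (a # w) \<subseteq> {..<k}"
      using aw(2) \<Delta>[OF aw(1)] digits by (fastforce simp: kleene_star_def)
    then have "rep k n = a # w"
      using rep_digits_value \<Delta>[OF aw(1)] aw(3) by blast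
    moreover from this have "n > 0"
      by (cases "n = 0") (auto simp: rep.simps[of k 0])
    ultimately show "n \<in> A"
      using aw by (auto simp: assms(8))
  qed
  have "finite \<Delta>"
    using assms(2,4) by (auto intro: finite_subset)
  have summable: "(\<lambda>n. real n powr (- s)) summable_on A \<longleftrightarrow> q s < 1" if "0 \<le> s" for s
  proof -
    note iff = summable_on_digits_value_iff[OF \<Delta> digits assms(6,7) that, folded q_power]
    show ?thesis
    proof
      assume sum: "(\<lambda>n. real n powr (- s)) summable_on A"
      \<comment> \<open>The criterion \<open>q s < 1\<close> is the same for every leading digit, so
        a single piece of \<open>A\<close> already forces it.\<close>
      obtain a where "a \<in> \<Delta>"
        using assms(3) by blast
      then have "(\<lambda>n. real n powr (- s)) summable_on (\<lambda>w. digits_value k (a # w)) ` kleene_star B"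
        using A by (intro summable_on_subset_banach[OF sum]) blast
      then show "q s < 1"
        using iff \<open>a \<in> \<Delta>\<close> by blast
    next
      assume "q s < 1"
      then show "(\<lambda>n. real n powr (- s)) summable_on A"
        unfolding A using iff \<open>finite \<Delta>\<close> by (intro summable_on_finite_UN) auto
    qed
  qed
  \<comment> \<open>The ray is open because the series diverges at \<open>r\<close> itself, where
    \<open>q r = 1\<close>. Since \<open>0 \<le> r\<close>, the constraint \<open>s \<ge> 0\<close>
    cuts nothing off.\<close>
  have "{s. s \<ge> 0 \<and> (\<lambda>n. real n powr (- s)) summable_on A} = {r<..}"
    using summable q_lt_1 \<open>0 \<le> r\<close> by auto
  then have "dim_zeta A = r"
    by (simp add: dim_zeta_def)
  then show ?thesis
    using root unfolding q_def by simp
qed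

end
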